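(* There is a constant $\kappa$ such that for every nondegenerate triangle $T\subset\mathbb{R}^2$ and every admissible simplex spline basis $\mathcal{B}=\{S_1,\dots,S_{39}\}$ of the space $\mathcal{S}^3_5$ of $C^3$ piecewise quintics on the Powell-Sabin 12-split of $T$ (see context for "admissible"), the $L_\infty$ condition number of $\mathcal{B}$ satisfies $$\left(\sup_{\boldsymbol{c}\ne0}\frac{\|\sum_{j}c_jS_j\|_{L_\infty(T)}}{\max_j|c_j|}\right)\left(\sup_{\boldsymbol{c}\ne0}\frac{\max_j|c_j|}{\|\sum_{j}c_jS_j\|_{L_\infty(T)}}\right)\le\kappa,$$ where $\boldsymbol{c}=(c_1,\dots,c_{39})$ ranges over $\mathbb{R}^{39}\setminus\{0\}$.
   Context: For $T=[\boldsymbol{v}_1,\boldsymbol{v}_2,\boldsymbol{v}_3]$ let $\boldsymbol{v}_4=(\boldsymbol{v}_1+\boldsymbol{v}_2)/2$, $\boldsymbol{v}_5=(\boldsymbol{v}_2+\boldsymbol{v}_3)/2$, $\boldsymbol{v}_6=(\boldsymbol{v}_1+\boldsymbol{v}_3)/2$. The Powell-Sabin 12-split of $T$ is the subdivision of $T$ into 12 triangles obtained by drawing all segments connecting pairs among $\boldsymbol{v}_1,\dots,\boldsymbol{v}_6$. Its ten vertices are $\boldsymbol{v}_1,\dots,\boldsymbol{v}_6$, $\boldsymbol{v}_7=(\boldsymbol{v}_4+\boldsymbol{v}_6)/2$, $\boldsymbol{v}_8=(\boldsymbol{v}_4+\boldsymbol{v}_5)/2$, $\boldsymbol{v}_9=(\boldsymbol{v}_5+\boldsymbol{v}_6)/2$,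 $\boldsymbol{v}_{10}=(\boldsymbol{v}_1+\boldsymbol{v}_2+\boldsymbol{v}_3)/3$. $\mathcal{S}^3_5$ is the space of $C^3$ functions on $T$ that are polynomials of total degree at most 5 on each of the 12 triangles; it has dimension 39. Simplex splines: let $K$ be a multiset of 8 points from $\{\boldsymbol{v}_1,\dots,\boldsymbol{v}_{10}\}$ whose convex hull has positive area. Choose a nondegenerate simplex $\sigma\subset\mathbb{R}^7$ whose 8 vertices are mapped onto the elements of $K$ (with multiplicity) by the projection $\pi:\mathbb{R}^7\to\mathbb{R}^2$ onto the first two coordinates. The simplex spline is $$Q[K](\boldsymbol{x})=\frac{\mathrm{area}(T)}{\binom{7}{2}}\cdot\frac{\mathrm{vol}_5(\sigma\cap\pi^{-1}(\boldsymbol{x}))}{\mathrm{vol}_7(\sigma)},\qquad \boldsymbol{x}\in T,$$ independent of the choice of $\sigma$. Admissible basis (for each $T$ there are precisely six of these): a set $\mathcal{B}=\{S_1,\dots,S_{39}\}$ with $S_j=w_jQ[K_j]$, $w_j>0$, such that: 1. $\mathcal{B}$ is a basis of $\mathcal{S}^3_5$. 2. $\mathcal{B}$ is mapped onto itself (by composition) by each of the six affine maps of $T$ onto itself permuting $\boldsymbol{v}_1,\boldsymbol{v}_2,\boldsymbol{v}_3$. 3. For each edge $[\boldsymbol{v}_i,\boldsymbol{v}_j]$ with midpoint $\boldsymbol{m}$, the nonzero restrictions to the edge of elements of $\mathcal{B}$ are, up to positive scaling, exactly the 8 univariate quintic B-splines for the knot multiset with $\boldsymbol{v}_i,\boldsymbol{m},\boldsymbol{v}_j$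 of multiplicities $6,2,6$, each occurring once. 4. $\sum_jS_j=1$ on $T$, and $(c_1\beta_1(\boldsymbol{x})+c_2\beta_2(\boldsymbol{x})+c_3\beta_3(\boldsymbol{x}))^5=\sum_jS_j(\boldsymbol{x})\Psi_j(c_1,c_2,c_3)$ for all $\boldsymbol{x}\in T$ and real $c_1,c_2,c_3$, where $\beta_i$ are the barycentric coordinates with respect to $T$ and each $\Psi_j$ is a product of five real linear forms, which can be written $\Psi_j=\prod_{r=1}^5(a_{j,r,1}c_1+a_{j,r,2}c_2+a_{j,r,3}c_3)$ with $\sum_ia_{j,r,i}=1$. 5. The domain points $\boldsymbol{\xi}_j=\frac15\sum_{r=1}^5(a_{j,r,1}\boldsymbol{v}_1+a_{j,r,2}\boldsymbol{v}_2+a_{j,r,3}\boldsymbol{v}_3)$ all lie in $T$, with precisely 8 of them on each edge of $T$. *)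

theory Defs
  imports "HOL-Analysis.Analysis" "HOL-Probability.Essential_Supremum" "HOL-Library.Multiset"
begin

section \<open>The Powell-Sabin 12-split\<close>

definition triangle_hull :: "(3 \<Rightarrow> real^2) \<Rightarrow> (real^2) set" where
  "triangle_hull v = convex hull (range v)"

definition ps12_corners :: "(3 \<Rightarrow> real^2) \<Rightarrow> (real^2) set" where
  "ps12_corners v =
    {v 1, v 2, v 3, midpoint (v 1) (v 2), midpoint (v 2) (v 3), midpoint (v 1) (v 3)}"

definition ps12_vertices :: "(3 \<Rightarrow> real^2) \<Rightarrow> (real^2) set" where
  "ps12_vertices v =
    (let v4 = midpoint (v 1) (v 2); v5 = midpoint (v 2) (v 3); v6 = midpoint (v 1) (v 3)
     in ps12_corners v \<union>
        {midpoint v4 v6, midpoint v4 v5, midpoint v5 v6, (1/3) *\<^sub>R (v 1 + v 2 + v 3)})"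

text \<open>Removing the segments (which include the three edges) from the triangle leaves the open
  cells of the split as connected components.\<close>

definition ps12_cells :: "(3 \<Rightarrow> real^2) \<Rightarrow> (real^2) set set" where
  "ps12_cells v = closure ` components
    (triangle_hull v - (\<Union>p\<in>ps12_corners v. \<Union>q\<in>ps12_corners v. closed_segment p q))"


section \<open>The spline space\<close>

text \<open>Derivatives are taken within the set. On a closed triangle with nonempty interior they are
  unique, and the class is that of the functions whose partial derivatives up to order \<open>k\<close>
  exist in the interior and extend continuously to the boundary.\<close>

primrec Ck_on :: "nat \<Rightarrow> (real^2) set \<Rightarrow> (real^2 \<Rightarrow> real) \<Rightarrow> bool" where
  "Ck_on 0 A f \<longleftrightarrow> continuous_on A f"
| "Ck_on (Suc k) A f \<longleftrightarrow>
    (\<exists>g :: 2 \<Rightarrow> real^2 \<Rightarrow> real.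
      (\<forall>x\<in>A. (f has_derivative (\<lambda>h. \<Sum>i\<in>UNIV. g i x * h $ i)) (at x within A)) \<and>
      (\<forall>i. Ck_on k A (g i)))"

definition polynomial_on :: "nat \<Rightarrow> (real^2) set \<Rightarrow> (real^2 \<Rightarrow> real) \<Rightarrow> bool" where
  "polynomial_on d A f \<longleftrightarrow>
    (\<exists>a :: nat \<Rightarrow> nat \<Rightarrow> real. \<forall>x\<in>A. f x = (\<Sum>i\<le>d. \<Sum>j\<le>d - i. a i j * (x $ 1) ^ i * (x $ 2) ^ j))"

text \<open>Here and below a function on the triangle is represented by any function on the plane;
  only its values on the triangle matter.\<close>

definition S35 :: "(3 \<Rightarrow> real^2) \<Rightarrow> (real^2 \<Rightarrow> real) set" where
  "S35 v = {f. Ck_on 3 (triangle_hull v) f \<and> (\<forall>\<Delta>\<in>ps12_cells v. polynomial_on 5 \<Delta> f)}"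

definition is_basis_on ::
  "(real^2) set \<Rightarrow> (real^2 \<Rightarrow> real) set \<Rightarrow> ('n::finite \<Rightarrow> real^2 \<Rightarrow> real) \<Rightarrow> bool" where
  "is_basis_on T V S \<longleftrightarrow>
    (\<forall>j. S j \<in> V) \<and>
    (\<forall>c :: real^'n. (\<forall>x\<in>T. (\<Sum>j\<in>UNIV. c $ j * S j x) = 0) \<longrightarrow> c = 0) \<and>
    (\<forall>f\<in>V. \<exists>c :: real^'n. \<forall>x\<in>T. f x = (\<Sum>j\<in>UNIV. c $ j * S j x))"


section \<open>Simplex splines\<close>

text \<open>The space \<open>\<real>\<^sup>7\<close> is taken as \<open>\<real>\<^sup>2 \<times> \<real>\<^sup>5\<close>, so that the projection is \<open>fst\<close> and
  the 5-dimensional volume of a fibre is the Lebesgue measure of a section.\<close>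

definition lifts_to_simplex :: "(real^2) multiset \<Rightarrow> ((real^2) \<times> (real^5)) set \<Rightarrow> bool" where
  "lifts_to_simplex K V \<longleftrightarrow>
    finite V \<and> card V = 8 \<and> \<not> affine_dependent V \<and> image_mset fst (mset_set V) = K"

definition simplex_spline :: "(3 \<Rightarrow> real^2) \<Rightarrow> (real^2) multiset \<Rightarrow> real^2 \<Rightarrow> real" where
  "simplex_spline v K x =
    (let \<sigma> = convex hull (SOME V. lifts_to_simplex K V)
     in measure lebesgue (triangle_hull v) / real (7 choose 2) *
        (measure lebesgue {y. (x, y) \<in> \<sigma>} / measure lebesgue \<sigma>))"

definition admissible_knots :: "(3 \<Rightarrow> real^2) \<Rightarrow> (real^2) multiset \<Rightarrow> bool" where
  "admissible_knots v K \<longleftrightarrow>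
    size K = 8 \<and> set_mset K \<subseteq> ps12_vertices v \<and>
    measure lebesgue (convex hull (set_mset K)) > 0"


section \<open>Univariate B-splines\<close>

text \<open>Cox-de Boor recursion; quotients with denominator \<open>0\<close> are \<open>0\<close>, as usual. The last nonempty
  knot interval is closed on the right, so that the B-splines are continuous from the left at the
  last knot.\<close>

fun bspline :: "real list \<Rightarrow> nat \<Rightarrow> nat \<Rightarrow> real \<Rightarrow> real" where
  "bspline ts 0 i t =
    (if ts ! i \<le> t \<and> t < ts ! Suc i \<or> ts ! i < t \<and> t = ts ! Suc i \<and> t = last ts then 1 else 0)"
| "bspline ts (Suc d) i t =
    (t - ts ! i) / (ts ! (i + Suc d) - ts ! i) * bspline ts d i t +
    (ts ! (i + d + 2) - t) / (ts ! (i + d + 2) - ts ! Suc i) * bspline ts d (Suc i) t"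

definition edge_knots :: "real list" where
  "edge_knots = replicate 6 0 @ replicate 2 (1/2) @ replicate 6 1"


section \<open>Admissible bases\<close>

definition bary :: "(3 \<Rightarrow> real^2) \<Rightarrow> real^2 \<Rightarrow> real^3" where
  "bary v x = (THE b. (\<Sum>i\<in>UNIV. b $ i) = 1 \<and> (\<Sum>i\<in>UNIV. b $ i *\<^sub>R v i) = x)"

definition symmetric_basis :: "(3 \<Rightarrow> real^2) \<Rightarrow> (39 \<Rightarrow> real^2 \<Rightarrow> real) \<Rightarrow> bool" where
  "symmetric_basis v S \<longleftrightarrow>
    (\<forall>L a. linear L \<and> (\<lambda>x. a + L x) ` range v = range v \<longrightarrow>
      range (\<lambda>j. restrict (S j \<circ> (\<lambda>x. a + L x)) (triangle_hull v)) =
      range (\<lambda>j. restrict (S j) (triangle_hull v)))"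

definition edge_bsplines :: "(3 \<Rightarrow> real^2) \<Rightarrow> (39 \<Rightarrow> real^2 \<Rightarrow> real) \<Rightarrow> bool" where
  "edge_bsplines v S \<longleftrightarrow>
    (\<forall>i j. i \<noteq> j \<longrightarrow>
      (\<exists>\<rho> :: nat \<Rightarrow> 39.
        bij_betw \<rho> {..<8} {k. \<exists>x\<in>closed_segment (v i) (v j). S k x \<noteq> 0} \<and>
        (\<forall>k<8. \<exists>s>0. \<forall>t\<in>{0..1}.
          S (\<rho> k) ((1 - t) *\<^sub>R v i + t *\<^sub>R v j) = s * bspline edge_knots 5 k t)))"

text \<open>The coefficients of the linear forms: \<open>a j r $ i\<close> is the coefficient of \<open>c\<^sub>i\<close> in the
  \<open>r\<close>-th factor of the \<open>j\<close>-th dual polynomial.\<close>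

definition marsden_identity ::
  "(3 \<Rightarrow> real^2) \<Rightarrow> (39 \<Rightarrow> real^2 \<Rightarrow> real) \<Rightarrow> (39 \<Rightarrow> 5 \<Rightarrow> real^3) \<Rightarrow> bool" where
  "marsden_identity v S a \<longleftrightarrow>
    (\<forall>j r. (\<Sum>i\<in>UNIV. a j r $ i) = 1) \<and>
    (\<forall>x\<in>triangle_hull v. \<forall>c :: real^3.
      (\<Sum>i\<in>UNIV. c $ i * bary v x $ i) ^ 5 =
      (\<Sum>j\<in>UNIV. S j x * (\<Prod>r\<in>UNIV. \<Sum>i\<in>UNIV. a j r $ i * c $ i)))"

definition domain_point ::
  "(3 \<Rightarrow> real^2) \<Rightarrow> (39 \<Rightarrow> 5 \<Rightarrow> real^3) \<Rightarrow> 39 \<Rightarrow> real^2" where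
  "domain_point v a j = (1/5) *\<^sub>R (\<Sum>r\<in>UNIV. \<Sum>i\<in>UNIV. a j r $ i *\<^sub>R v i)"

definition admissible_basis :: "(3 \<Rightarrow> real^2) \<Rightarrow> (39 \<Rightarrow> real^2 \<Rightarrow> real) \<Rightarrow> bool" where
  "admissible_basis v S \<longleftrightarrow>
    (\<exists>(w :: 39 \<Rightarrow> real) (K :: 39 \<Rightarrow> (real^2) multiset).
      \<forall>j. w j > 0 \<and> admissible_knots v (K j) \<and>
          (\<forall>x\<in>triangle_hull v. S j x = w j * simplex_spline v (K j) x)) \<and>
    is_basis_on (triangle_hull v) (S35 v) S \<and>
    symmetric_basis v S \<and>
    edge_bsplines v S \<and>
    (\<forall>x\<in>triangle_hull v. (\<Sum>j\<in>UNIV. S j x) = 1) \<and>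
    (\<exists>a. marsden_identity v S a \<and>
      (\<forall>j. domain_point v a j \<in> triangle_hull v) \<and>
      (\<forall>i k. i \<noteq> k \<longrightarrow> card {j. domain_point v a j \<in> closed_segment (v i) (v k)} = 8))"


section \<open>The condition number\<close>

text \<open>Norms and suprema take values in \<open>ennreal\<close>, so that an unbounded supremum is infinite and a
  positive number divided by \<open>0\<close> is infinite.\<close>

definition Linf_norm :: "(real^2) set \<Rightarrow> (real^2 \<Rightarrow> real) \<Rightarrow> ennreal" where
  "Linf_norm T f = esssup (lebesgue_on T) (\<lambda>x. ennreal \<bar>f x\<bar>)"

definition max_abs :: "real^('n::finite) \<Rightarrow> ennreal" where
  "max_abs c = ennreal (MAX j. \<bar>c $ j\<bar>)"

definition condition_number ::
  "(real^2) set \<Rightarrow> ('n::finite \<Rightarrow> real^2 \<Rightarrow> real) \<Rightarrow> ennreal" where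
  "condition_number T S =
    (SUP c \<in> UNIV - {0 :: real^'n}. Linf_norm T (\<lambda>x. \<Sum>j\<in>UNIV. c $ j * S j x) / max_abs c) *
    (SUP c \<in> UNIV - {0 :: real^'n}. max_abs c / Linf_norm T (\<lambda>x. \<Sum>j\<in>UNIV. c $ j * S j x))"

end

theory Submission
  imports Defs
begin

text \<open>
  The condition number of an admissible basis takes only finitely many values, all of them finite,
  so \<open>\<kappa>\<close> can be taken as their maximum.

  Every knot is one of ten points whose barycentric coordinates do not depend on the triangle. Writing
  the knots in these coordinates attaches to a basis a labelling by 39 multisets of size 8 over
  a fixed finite set, and there are finitely many labellings. The condition number is a function of
  the labelling (\<open>same_labels_imp_same_condition_number\<close>): if two bases carry the same one, the
  affine map \<open>\<phi>\<close> between their triangles takes the knots of one to the knots of the other, and then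
  \<open>S' j \<circ> \<phi> = u j * S j\<close> for constants \<open>u j\<close>. These are all \<open>1\<close>, because both bases sum to one and
  \<open>S\<close> is linearly independent; thus the weights, which range over a continuum, are in fact
  determined by the knots. Since \<open>S' j \<circ> \<phi> = S j\<close> and the supremum norm ignores a change of
  variables, the condition numbers agree.

  The constants \<open>u j\<close> come from \<open>fibre_measure_scales\<close>: the fibre volumes of two simplices over
  matching knots differ by the Jacobian of one linear map of the fibre direction. The areas and the
  volumes in the normalisation of the simplex spline enter the constants as well and are fixed
  together with them by the partition of unity.

  A single condition number is finite (\<open>condition_number_finite\<close>): a nonnegative partition of unity
  bounds the synthesis operator by \<open>1\<close>, and linear independence together with the compactness of the
  unit sphere bounds its inverse.
\<close>

section \<open>Affine maps\<close>

text \<open>After a translation moving one point of \<open>V\<close> to the origin, the remaining points are linearly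
  independent.\<close>

lemma affine_extension_exists:
  fixes V :: "'a::euclidean_space set" and f :: "'a \<Rightarrow> 'b::euclidean_space"
  assumes "\<not> affine_dependent V"
  obtains d g where "linear g" "\<And>x. x \<in> V \<Longrightarrow> d + g x = f x"
proof (cases "V = {}")
  case True
  then show ?thesis
    using that[of "\<lambda>_. 0" 0] by (simp add: module_hom_zero)
next
  case False
  then obtain a W where V: "V = insert a W" "a \<notin> W"
    by (meson Set.set_insert ex_in_conv)
  then have ind: "independent ((\<lambda>x. - a + x) ` W)"
    using assms affine_dependent_iff_dependent by blast
  obtain g where g: "linear g" "\<forall>y\<in>(\<lambda>x. - a + x) ` W. g y = f (a + y) - f a"
    using linear_independent_extend[OF ind, of "\<lambda>y. f (a + y) - f a"] by auto
  have "f a - g a + g x = f x" if "x \<in> V" for x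
  proof (cases "x = a")
    case False
    then have "g (- a + x) = f x - f a"
      using g(2) that V by auto
    then show ?thesis
      using g(1) by (simp add: linear_diff algebra_simps)
  qed simp
  then show ?thesis
    using that g(1) by blast
qed

lemma affine_maps_agree:
  fixes g g' :: "'a::real_vector \<Rightarrow> 'b::real_vector"
  assumes "linear g" "linear g'" and agree: "\<And>x. x \<in> V \<Longrightarrow> d + g x = d' + g' x"
    and full: "affine hull V = UNIV"
  shows "d + g x = d' + g' x"
proof -
  have "affine {x. d + g x = d' + g' x}"
  proof (clarsimp simp: affine_def)
    fix x y and u v :: real
    assume x: "d + g x = d' + g' x" and y: "d + g y = d' + g' y" and uv: "u + v = 1"
    have *: "e + k (u *\<^sub>R x + v *\<^sub>R y) = u *\<^sub>R (e + k x) + v *\<^sub>R (e + k y)"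
      if "linear k" for e :: 'b and k
    proof -
      have "u *\<^sub>R e + v *\<^sub>R e = e"
        by (metis uv scaleR_left_distrib scaleR_one)
      then show ?thesis
        using that by (simp add: linear_add linear_scale scaleR_add_right algebra_simps)
    qed
    show "d + g (u *\<^sub>R x + v *\<^sub>R y) = d' + g' (u *\<^sub>R x + v *\<^sub>R y)"
      unfolding *[OF assms(1)] *[OF assms(2)] x y ..
  qed
  then have "affine hull V \<subseteq> {x. d + g x = d' + g' x}"
    using agree by (intro hull_minimal) auto
  then show ?thesis
    using full by auto
qed

section \<open>Simplices over a knot multiset\<close>

text \<open>Since a knot may be repeated, equality of the knot multisets only gives some matching of the
  vertices, chosen one vertex at a time.\<close>

lemma matching_exists:
  assumes "finite V" "finite V'" "image_mset f (mset_set V) = image_mset f' (mset_set V')"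
  shows "\<exists>\<sigma>. bij_betw \<sigma> V V' \<and> (\<forall>p\<in>V. f' (\<sigma> p) = f p)"
  using assms
proof (induction V arbitrary: V' rule: finite_induct)
  case empty
  then have "V' = {}"
    by (auto simp: mset_set_empty_iff)
  then show ?case by (simp add: bij_betw_def)
next
  case (insert p V)
  from insert.hyps insert.prems have "f p \<in># image_mset f' (mset_set V')"
    by (metis image_mset_add_mset mset_set.insert union_single_eq_member)
  then obtain q where q: "q \<in> V'" "f' q = f p"
    using insert.prems by auto
  have "mset_set V' = add_mset q (mset_set (V' - {q}))"
    using q(1) insert.prems(1) by (simp add: mset_set.remove)
  then have "image_mset f (mset_set V) = image_mset f' (mset_set (V' - {q}))"
    using insert.prems insert.hyps q(2) by simp
  then obtain \<sigma> where \<sigma>: "bij_betw \<sigma> V (V' - {q})" "\<forall>p\<in>V. f' (\<sigma> p) = f p"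
    using insert.IH[of "V' - {q}"] insert.prems by auto
  have "bij_betw (\<sigma>(p := q)) V (V' - {q})"
    using \<sigma>(1) insert.hyps by (subst bij_betw_cong[of V _ \<sigma>]) auto
  then have "bij_betw (\<sigma>(p := q)) (insert p V) V'"
    using notIn_Un_bij_betw[of p V "\<sigma>(p := q)" "V' - {q}"] insert.hyps q(1)
    by (simp add: insert_absorb)
  moreover have "\<forall>p'\<in>insert p V. f' ((\<sigma>(p := q)) p') = f p'"
    using \<sigma>(2) q(2) by auto
  ultimately show ?case
    by blast
qed

text \<open>The affine map that takes the vertices of one simplex to the matching vertices of the other lies
  over the map \<open>x \<mapsto> d + g x\<close> of the knots, hence carries fibres onto fibres. On the fibre over \<open>x\<close> it
  is a translation depending on \<open>x\<close> after a linear map \<open>C\<close> not depending on \<open>x\<close>, so the fibre volumes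
  are scaled by the constant \<open>\<bar>det C\<bar>\<close>. With \<open>d = 0\<close> and \<open>g\<close> the identity this is the independence of
  the simplex spline, up to a factor, from the chosen simplex.\<close>

lemma fibre_measure_scales:
  assumes V: "lifts_to_simplex K V" and V': "lifts_to_simplex (image_mset (\<lambda>x. d + g x) K) V'"
    and g: "linear g" "inj g"
  obtains r where "\<And>x. measure lebesgue {y. (d + g x, y) \<in> convex hull V'} =
                        r * measure lebesgue {y. (x, y) \<in> convex hull V}"
proof -
  have fin: "finite V" "finite V'" and ind: "\<not> affine_dependent V"
    using V V' by (auto simp: lifts_to_simplex_def)
  have full: "affine hull V = UNIV"
    using V by (intro affine_independent_span_eq) (auto simp: lifts_to_simplex_def)
  have "image_mset (\<lambda>p. d + g (fst p)) (mset_set V) = image_mset fst (mset_set V')"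
    using V V' by (auto simp: lifts_to_simplex_def multiset.map_comp comp_def)
  then obtain \<sigma> where \<sigma>: "bij_betw \<sigma> V V'" "\<And>p. p \<in> V \<Longrightarrow> fst (\<sigma> p) = d + g (fst p)"
    using matching_exists[OF fin] by metis
  obtain e h where h: "linear h" "\<And>p. p \<in> V \<Longrightarrow> e + h p = \<sigma> p"
    using affine_extension_exists[OF ind] by blast
  have hull: "convex hull V' = (\<lambda>p. e + h p) ` (convex hull V)"
  proof -
    have "V' = (\<lambda>p. e + h p) ` V"
      using \<sigma>(1) h(2) by (auto simp: bij_betw_def)
    then have "V' = (+) e ` h ` V"
      by (simp add: image_image)
    then have "convex hull V' = (+) e ` h ` (convex hull V)"
      using h(1) by (simp only: convex_hull_translation convex_hull_linear_image)
    then show ?thesis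
      by (simp add: image_image)
  qed
  have over: "fst (e + h p) = d + g (fst p)" for p
  proof -
    have "fst e + (fst \<circ> h) p = d + (g \<circ> fst) p"
    proof (rule affine_maps_agree[OF _ _ _ full])
      show "linear (fst \<circ> h)" "linear (g \<circ> fst)"
        using h(1) g(1) by (auto intro!: linear_compose linear_fst)
      show "fst e + (fst \<circ> h) q = d + (g \<circ> fst) q" if "q \<in> V" for q
        using h(2)[OF that] \<sigma>(2)[OF that] by (metis comp_apply fst_add)
    qed
    then show ?thesis by simp
  qed
  define C where "C y = snd (h (0, y))" for y
  have C: "linear C"
    unfolding C_def by (intro linearI) (simp_all add: linear_add[OF h(1), symmetric] linear_scale[OF h(1), symmetric] flip: snd_add snd_scaleR)
  define s where "s x = snd (e + h (x, 0))" for x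
  have split: "e + h (x, y) = (d + g x, s x + C y)" for x y
  proof (rule prod_eqI)
    show "fst (e + h (x, y)) = fst (d + g x, s x + C y)"
      using over[of "(x, y)"] by simp
    have "h (x, y) = h (x, 0) + h (0, y)"
      by (simp add: linear_add[OF h(1), symmetric])
    then show "snd (e + h (x, y)) = snd (d + g x, s x + C y)"
      by (simp add: C_def s_def)
  qed
  have "measure lebesgue {y. (d + g x, y) \<in> convex hull V'} =
        \<bar>det (matrix C)\<bar> * measure lebesgue {y. (x, y) \<in> convex hull V}" for x
  proof -
    let ?F = "{y. (x, y) \<in> convex hull V}"
    have "{y. (d + g x, y) \<in> convex hull V'} = (+) (s x) ` C ` ?F"
    proof (intro set_eqI iffI)
      fix z assume "z \<in> {y. (d + g x, y) \<in> convex hull V'}"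
      then obtain x' y where p: "(x', y) \<in> convex hull V" "(d + g x, z) = e + h (x', y)"
        by (auto simp: hull)
      then have "x' = x" "z = s x' + C y"
        using g(2) by (simp_all add: split inj_eq)
      then show "z \<in> (+) (s x) ` C ` ?F"
        using p(1) by blast
    next
      fix z assume "z \<in> (+) (s x) ` C ` ?F"
      then obtain y where y: "(x, y) \<in> convex hull V" "z = s x + C y"
        by blast
      then have "(d + g x, z) = e + h (x, y)"
        by (simp add: split)
      then show "z \<in> {y. (d + g x, y) \<in> convex hull V'}"
        using y(1) by (auto simp: hull)
    qed
    moreover have "?F = snd ` (convex hull V \<inter> {x} \<times> UNIV)"
      by force
    have "compact (convex hull V)"
      using fin(1) finite_imp_compact_convex_hull by blast
    then have "compact ?F"
      unfolding \<open>?F = _\<close> by (intro compact_continuous_image continuous_intros compact_Int_closed closed_Times) auto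
    then have "?F \<in> lmeasurable"
      by (rule lmeasurable_compact)
    ultimately show ?thesis
      using C by (simp only: measure_translation measure_linear_image)
  qed
  then show ?thesis
    using that by blast
qed

text \<open>Three of the knots form an affine basis of the plane and are placed at height \<open>0\<close>; the
  other five are lifted along the five coordinate directions of the fibre. The choice operator in the
  definition of the simplex spline therefore picks a genuine simplex.\<close>

lemma lift_exists:
  assumes K: "size K = 8" and pos: "measure lebesgue (convex hull (set_mset K)) > 0"
  shows "\<exists>V. lifts_to_simplex K V"
proof -
  have "interior (convex hull set_mset K) \<noteq> {}"
    using pos negligible_imp_measure0 negligible_convex_interior[OF convex_convex_hull] by force
  then have full: "affine hull set_mset K = UNIV"
    by (metis affine_hull_convex_hull affine_hull_nonempty_interior)
  obtain B where B: "B \<subseteq> set_mset K" "\<not> affine_dependent B" "affine hull B = UNIV"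
    using affine_basis_exists[of "set_mset K"] full by auto
  have finB: "finite B"
    using B(2) aff_independent_finite by blast
  have cardB: "card B = 3"
    using aff_dim_unique[of B UNIV] B by simp
  have sub: "mset_set B \<subseteq># K"
    using B(1) by (meson finite_set_mset msubset_mset_set_iff mset_set_set_mset_msubset subset_mset.order_trans finB)
  define R where "R = K - mset_set B"
  have K_eq: "K = mset_set B + R"
    using sub by (simp add: R_def)
  have "size R = 5"
    using K cardB K_eq by simp
  then obtain rs where rs: "mset rs = R" "length rs = 5"
    by (metis ex_mset size_mset)
  obtain idx where idx: "bij_betw idx (UNIV :: 5 set) {0..<5::nat}"
    using ex_bij_betw_finite_nat[of "UNIV :: 5 set"] by auto
  define r where "r i = rs ! idx i" for i
  have R_eq: "image_mset r (mset_set UNIV) = R"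
  proof -
    have "image_mset r (mset_set UNIV) = image_mset ((!) rs) (image_mset idx (mset_set UNIV))"
      unfolding r_def multiset.map_comp comp_def ..
    also have "image_mset idx (mset_set UNIV) = mset [0..<length rs]"
      using idx rs(2) by (simp add: image_mset_mset_set bij_betw_def)
    also have "image_mset ((!) rs) \<dots> = mset (map ((!) rs) [0..<length rs])"
      by (simp only: mset_map)
    also have "\<dots> = R"
      by (simp only: map_nth rs(1))
    finally show ?thesis .
  qed
  define V1 :: "((real^2) \<times> (real^5)) set" where "V1 = (\<lambda>b. (b, 0)) ` B"
  define V2 where "V2 = range (\<lambda>i. (r i, axis i (1::real)))"
  have inj1: "inj_on (\<lambda>b. (b, 0 :: real^5)) B"
    by (auto simp: inj_on_def)
  have inj2: "inj (\<lambda>i. (r i, axis i (1::real)))"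
    by (auto simp: inj_on_def axis_eq_axis)
  have fin: "finite V1" "finite V2"
    using finB by (auto simp: V1_def V2_def)
  have disj: "V1 \<inter> V2 = {}"
    by (auto simp: V1_def V2_def axis_eq_0_iff dest: sym)
  have card: "card (V1 \<union> V2) = 8"
    using fin disj cardB inj1 inj2 by (simp add: card_Un_disjoint V1_def V2_def card_image)
  have "image_mset fst (mset_set (V1 \<union> V2)) = mset_set B + R"
  proof -
    have "image_mset fst (mset_set V1) = mset_set B"
      by (simp add: V1_def inj1 image_mset_mset_set[symmetric] multiset.map_comp comp_def)
    moreover have "image_mset fst (mset_set V2) = R"
      by (simp add: V2_def inj2 image_mset_mset_set[symmetric] multiset.map_comp comp_def R_eq)
    ultimately show ?thesis
      using fin disj by (simp add: mset_set_Union)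
  qed
  moreover have "\<not> affine_dependent (V1 \<union> V2)"
  proof -
    let ?W = "affine hull (V1 \<union> V2)"
    have base: "(x, 0) \<in> ?W" for x
    proof -
      have "affine hull V1 = (\<lambda>b. (b, 0)) ` (affine hull B)"
        unfolding V1_def by (rule affine_hull_linear_image[symmetric])
          (intro bounded_linear_Pair bounded_linear_ident bounded_linear_zero)
      then have "(x, 0) \<in> affine hull V1"
        using B(3) by auto
      then show ?thesis
        using hull_mono[of V1 "V1 \<union> V2"] by auto
    qed
    then have W: "subspace ?W"
      using affine_affine_hull subspace_affine[of ?W] by (auto simp: zero_prod_def)
    have up: "(0, axis i 1) \<in> ?W" for i
    proof -
      have "(r i, axis i 1) \<in> ?W"
        by (rule hull_inc) (simp add: V2_def)
      from subspace_diff[OF W this base[of "r i"]] show ?thesis by simp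
    qed
    have "?W = UNIV"
    proof (intro set_eqI iffI)
      fix z :: "(real^2) \<times> (real^5)"
      obtain x y where z: "z = (x, y)" by (cases z)
      have "(0, y) = (\<Sum>i\<in>UNIV. y $ i *\<^sub>R (0::real^2, axis i (1::real)))"
        by (intro prod_eqI) (simp_all add: fst_sum snd_sum basis_expansion scalar_mult_eq_scaleR[symmetric])
      also have "\<dots> \<in> ?W"
        using up W by (intro subspace_sum subspace_scale) auto
      finally have "(x, 0) + (0, y) \<in> ?W"
        using base W by (intro subspace_add) auto
      then show "z \<in> ?W"
        by (simp add: z)
    qed auto
    then have "aff_dim (V1 \<union> V2) = 7"
      using aff_dim_eq_full[of "V1 \<union> V2"] by simp
    then show ?thesis
      using fin card affine_independent_iff_card[of "V1 \<union> V2"] by simp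
  qed
  ultimately have "lifts_to_simplex K (V1 \<union> V2)"
    using card fin K_eq by (simp add: lifts_to_simplex_def)
  then show ?thesis ..
qed


section \<open>Geometry of the triangle\<close>

lemma compact_triangle_hull: "compact (triangle_hull v)"
  unfolding triangle_hull_def by (intro finite_imp_compact_convex_hull) simp

lemma range_eq_three: "range (v :: 3 \<Rightarrow> 'a) = {v 1, v 2, v 3}"
  by (simp add: UNIV_3)

lemma vertices_affinely_independent:
  fixes v :: "3 \<Rightarrow> real^2"
  assumes "\<not> collinear {v 1, v 2, v 3}"
  shows "inj v" "\<not> affine_dependent (range v)" "affine hull range v = UNIV"
proof -
  have *: "v 1 \<noteq> v 2" "v 1 \<noteq> v 3" "v 2 \<noteq> v 3" "\<not> affine_dependent {v 1, v 2, v 3}"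
    using assms by (auto simp: collinear_3_eq_affine_dependent)
  show "inj v"
    using * unfolding inj_def forall_3 by auto
  show ind: "\<not> affine_dependent (range v)"
    using * by (simp add: range_eq_three)
  show "affine hull range v = UNIV"
    using * by (intro affine_independent_span_eq ind) (simp add: range_eq_three)
qed

lemma closure_interior_triangle_hull:
  assumes "\<not> collinear {v 1, v 2, v 3}"
  shows "closure (interior (triangle_hull v)) = triangle_hull v"
proof -
  have "affine hull triangle_hull v = UNIV"
    using vertices_affinely_independent(3)[OF assms] by (simp add: triangle_hull_def)
  then have "interior (triangle_hull v) = rel_interior (triangle_hull v)"
    by (rule rel_interior_interior[symmetric])
  moreover have "rel_interior (triangle_hull v) \<noteq> {}"
    by (simp add: triangle_hull_def rel_interior_eq_empty)
  ultimately have "closure (interior (triangle_hull v)) = closure (triangle_hull v)"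
    by (intro convex_closure_interior) (simp_all add: triangle_hull_def)
  then show ?thesis
    by (simp add: compact_imp_closed compact_triangle_hull)
qed

lemma affine_iso_of_triangles:
  fixes v v' :: "3 \<Rightarrow> real^2"
  assumes "\<not> collinear {v 1, v 2, v 3}" "\<not> collinear {v' 1, v' 2, v' 3}"
  obtains d g where "linear g" "inj g" "\<And>i. d + g (v i) = v' i"
proof -
  note V = vertices_affinely_independent[OF assms(1)] and V' = vertices_affinely_independent[OF assms(2)]
  obtain d g where g: "linear g" "\<And>x. x \<in> range v \<Longrightarrow> d + g x = v' (inv v x)"
    using affine_extension_exists[OF V(2), of "\<lambda>x. v' (inv v x)"] by blast
  obtain d' g' where g': "linear g'" "\<And>x. x \<in> range v' \<Longrightarrow> d' + g' x = v (inv v' x)"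
    using affine_extension_exists[OF V'(2), of "\<lambda>x. v (inv v' x)"] by blast
  have gv: "d + g (v i) = v' i" and g'v: "d' + g' (v' i) = v i" for i
    using g(2) g'(2) V(1) V'(1) by auto
  have "(d' + g' d) + (g' \<circ> g) x = 0 + id x" for x
  proof (rule affine_maps_agree[where g = "g' \<circ> g" and g' = id, OF _ _ _ V(3)])
    show "linear (g' \<circ> g)"
      using g(1) g'(1) by (rule linear_compose)
    show "linear (id :: real^2 \<Rightarrow> real^2)"
      by (rule linear_id)
    show "(d' + g' d) + (g' \<circ> g) x = 0 + id x" if x: "x \<in> range v" for x
    proof -
      obtain i where "x = v i" using x by auto
      then show ?thesis
        using gv[of i] g'v[of i] linear_add[OF g'(1), of d "g x"] by (simp add: add.assoc)
    qed
  qed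
  then have "g x = g y \<Longrightarrow> x = y" for x y
    by (metis add_0 comp_apply id_apply)
  then have "inj g"
    by (rule injI)
  then show ?thesis
    using that g(1) gv by blast
qed

lemma affine_image_triangle_hull:
  assumes "linear g" "\<And>i. d + g (v i) = v' i"
  shows "(\<lambda>x. d + g x) ` triangle_hull v = triangle_hull v'"
proof -
  have "range v' = (+) d ` g ` range v"
    using assms(2) by (auto simp: image_image)
  then have "convex hull range v' = (+) d ` g ` (convex hull range v)"
    using assms(1) by (simp only: convex_hull_translation convex_hull_linear_image)
  then show ?thesis
    by (simp add: triangle_hull_def image_image)
qed

section \<open>The condition number of continuous functions\<close>

text \<open>The essential supremum of a continuous function could fall short of its supremum only if the
  set where the function is large missed the interior of \<open>T\<close>; density of the interior excludes this.
  For suprema, invariance under a change of variables is immediate, while for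
  essential suprema it would need the behaviour of null sets.\<close>

lemma Linf_norm_eq_SUP:
  assumes T: "compact T" "closure (interior T) = T" and f: "continuous_on T f"
  shows "Linf_norm T f = (SUP x\<in>T. ennreal \<bar>f x\<bar>)"
proof (rule antisym)
  have T_sets: "T \<in> sets lebesgue"
    using T(1) by (simp add: fmeasurableD lmeasurable_compact)
  have meas: "(\<lambda>x. ennreal \<bar>f x\<bar>) \<in> borel_measurable (lebesgue_on T)"
    using continuous_imp_measurable_on_sets_lebesgue[OF f T_sets] by measurable
  show "Linf_norm T f \<le> (SUP x\<in>T. ennreal \<bar>f x\<bar>)"
    unfolding Linf_norm_def
    by (intro esssup_I meas AE_I2 SUP_upper) simp
  show "(SUP x\<in>T. ennreal \<bar>f x\<bar>) \<le> Linf_norm T f"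
  proof (rule SUP_least, rule ccontr)
    fix x0 assume x0: "x0 \<in> T" and "\<not> ennreal \<bar>f x0\<bar> \<le> Linf_norm T f"
    then have less: "Linf_norm T f < ennreal \<bar>f x0\<bar>"
      by simp
    then obtain r where r: "Linf_norm T f = ennreal r" "r \<ge> 0"
      by (cases "Linf_norm T f") (auto simp: top_unique)
    have r_less: "r < \<bar>f x0\<bar>"
      using less r by (simp add: ennreal_less_iff)
    have "AE x in lebesgue_on T. ennreal \<bar>f x\<bar> \<le> ennreal r"
      using esssup_AE[of "\<lambda>x. ennreal \<bar>f x\<bar>" "lebesgue_on T"] r(1) by (simp add: Linf_norm_def)
    then have ae: "AE x in lebesgue. x \<in> T \<longrightarrow> \<bar>f x\<bar> \<le> r"
      using T_sets r(2) by (simp add: AE_restrict_space_iff)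
    have "continuous_on T (\<lambda>x. \<bar>f x\<bar>)"
      by (intro continuous_intros f)
    then obtain U where U: "open U" "U \<inter> T = (\<lambda>x. \<bar>f x\<bar>) -` {r<..} \<inter> T"
      unfolding continuous_on_open_invariant by (meson open_greaterThan)
    have "x0 \<in> U \<inter> closure (interior T)"
      using x0 r_less U(2) T(2) by auto
    then have ne: "U \<inter> interior T \<noteq> {}"
      using open_Int_closure_eq_empty[OF U(1)] by blast
    have "AE x in lebesgue. x \<notin> U \<inter> interior T"
    proof (rule eventually_mono[OF ae])
      fix x assume x: "x \<in> T \<longrightarrow> \<bar>f x\<bar> \<le> r"
      have "x \<in> U \<inter> interior T \<Longrightarrow> x \<in> (\<lambda>x. \<bar>f x\<bar>) -` {r<..} \<inter> T"
        using U(2) interior_subset by blast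
      then show "x \<notin> U \<inter> interior T" using x by auto
    qed
    then have "negligible (U \<inter> interior T)"
      using U(1) AE_iff_null_sets[of "U \<inter> interior T" lebesgue]
      by (auto simp: negligible_iff_null_sets)
    then show False
      using open_not_negligible[of "U \<inter> interior T"] ne U(1) by auto
  qed
qed

lemma condition_number_transfer:
  fixes S S' :: "'n::finite \<Rightarrow> real^2 \<Rightarrow> real"
  assumes T: "compact T" "closure (interior T) = T" and S: "\<And>j. continuous_on T (S j)"
    and T': "compact T'" "closure (interior T') = T'" and S': "\<And>j. continuous_on T' (S' j)"
    and T'_eq: "T' = \<phi> ` T" and eq: "\<And>j x. x \<in> T \<Longrightarrow> S' j (\<phi> x) = S j x"
  shows "condition_number T' S' = condition_number T S"
proof -
  have "Linf_norm T' (\<lambda>x. \<Sum>j\<in>UNIV. c $ j * S' j x) = Linf_norm T (\<lambda>x. \<Sum>j\<in>UNIV. c $ j * S j x)"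
    for c :: "real^'n"
  proof -
    have "Linf_norm T' (\<lambda>x. \<Sum>j\<in>UNIV. c $ j * S' j x) = (SUP x\<in>T'. ennreal \<bar>\<Sum>j\<in>UNIV. c $ j * S' j x\<bar>)"
      by (intro Linf_norm_eq_SUP T' continuous_intros S')
    also have "\<dots> = (SUP x\<in>T. ennreal \<bar>\<Sum>j\<in>UNIV. c $ j * S j x\<bar>)"
      unfolding T'_eq image_image by (intro SUP_cong refl) (simp add: eq)
    also have "\<dots> = Linf_norm T (\<lambda>x. \<Sum>j\<in>UNIV. c $ j * S j x)"
      by (intro Linf_norm_eq_SUP[symmetric] T continuous_intros S)
    finally show ?thesis .
  qed
  then show ?thesis
    by (simp add: condition_number_def)
qed

lemma abs_combination_le:
  fixes S :: "'n::finite \<Rightarrow> 'a \<Rightarrow> real"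
  assumes "\<And>j. 0 \<le> S j x" "(\<Sum>j\<in>UNIV. S j x) = 1" "\<And>j. \<bar>c j\<bar> \<le> M"
  shows "\<bar>\<Sum>j\<in>UNIV. c j * S j x\<bar> \<le> M"
proof -
  have "\<bar>\<Sum>j\<in>UNIV. c j * S j x\<bar> \<le> (\<Sum>j\<in>UNIV. M * S j x)"
    by (rule order_trans[OF sum_abs sum_mono]) (use assms in \<open>simp add: abs_mult mult_right_mono\<close>)
  then show ?thesis
    using assms(2) by (simp add: sum_distrib_left[symmetric])
qed

text \<open>The supremum \<open>N\<close> over \<open>T\<close> of the combination with coefficients \<open>c\<close> is 1-Lipschitz in \<open>c\<close> because
  the functions form a nonnegative partition of unity, so it has a minimum on the unit sphere, positive
  by linear independence. Half of the minimum serves as \<open>\<delta>\<close>, since the supremum over \<open>T\<close> need not be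
  attained.\<close>

lemma combination_bounded_below:
  fixes S :: "'n::finite \<Rightarrow> 'a \<Rightarrow> real"
  assumes T: "T \<noteq> {}"
    and nonneg: "\<And>j x. x \<in> T \<Longrightarrow> 0 \<le> S j x" and unity: "\<And>x. x \<in> T \<Longrightarrow> (\<Sum>j\<in>UNIV. S j x) = 1"
    and indep: "\<And>c :: real^'n. (\<forall>x\<in>T. (\<Sum>j\<in>UNIV. c $ j * S j x) = 0) \<Longrightarrow> c = 0"
  obtains \<delta> where "\<delta> > 0"
    "\<And>c :: real^'n. c \<noteq> 0 \<Longrightarrow> \<exists>x\<in>T. \<delta> * norm c < \<bar>\<Sum>j\<in>UNIV. c $ j * S j x\<bar>"
proof -
  define f where "f c x = (\<Sum>j\<in>UNIV. c $ j * S j x)" for c :: "real^'n" and x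
  define N where "N c = (SUP x\<in>T. \<bar>f c x\<bar>)" for c
  have f_le: "\<bar>f c x\<bar> \<le> norm c" if "x \<in> T" for c x
    unfolding f_def using that by (intro abs_combination_le nonneg unity component_le_norm_cart)
  have bdd: "bdd_above ((\<lambda>x. \<bar>f c x\<bar>) ` T)" for c
    using f_le by (intro bdd_aboveI2)
  have f_diff: "f c x - f d x = f (c - d) x" for c d x
    by (simp add: f_def sum_subtractf left_diff_distrib)
  have N_le: "N c \<le> N d + norm (c - d)" for c d
    unfolding N_def
  proof (rule cSUP_least[OF T])
    fix x assume x: "x \<in> T"
    have "\<bar>f c x\<bar> \<le> \<bar>f d x\<bar> + \<bar>f (c - d) x\<bar>"
      using f_diff[of c x d] by linarith
    also have "\<dots> \<le> (SUP x\<in>T. \<bar>f d x\<bar>) + norm (c - d)"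
      by (intro add_mono cSUP_upper x bdd f_le)
    finally show "\<bar>f c x\<bar> \<le> (SUP x\<in>T. \<bar>f d x\<bar>) + norm (c - d)" .
  qed
  have "1-lipschitz_on (sphere 0 1) N"
  proof (rule lipschitz_onI)
    show "dist (N c) (N d) \<le> 1 * dist c d" for c d
      using N_le[of c d] N_le[of d c] by (simp add: dist_norm norm_minus_commute abs_le_iff)
  qed simp
  then have "continuous_on (sphere 0 1) N"
    by (rule lipschitz_on_continuous_on)
  moreover have "axis undefined 1 \<in> (sphere 0 1 :: (real^'n) set)"
    by simp
  ultimately obtain c0 where c0: "norm c0 = 1" "\<And>c. norm c = 1 \<Longrightarrow> N c0 \<le> N c"
    using continuous_attains_inf[OF compact_sphere[of "0 :: real^'n" 1]] by (force simp: dist_norm)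
  have "c0 \<noteq> 0"
    using c0(1) by auto
  then obtain x where "x \<in> T" "f c0 x \<noteq> 0"
    using indep unfolding f_def by blast
  then have "N c0 > 0"
    unfolding N_def by (intro less_le_trans[OF _ cSUP_upper[OF _ bdd]]) auto
  have "\<exists>x\<in>T. N c0 / 2 * norm c < \<bar>f c x\<bar>" if "c \<noteq> 0" for c
  proof -
    let ?u = "(1 / norm c) *\<^sub>R c"
    have "N c0 / 2 < N ?u"
      using c0(2)[of ?u] \<open>c \<noteq> 0\<close> \<open>N c0 > 0\<close> by simp
    then obtain x where x: "x \<in> T" "N c0 / 2 < \<bar>f ?u x\<bar>"
      unfolding N_def using less_cSUP_iff[OF T bdd] by blast
    have "f ?u x = f c x / norm c"
      by (simp add: f_def sum_divide_distrib)
    then have "\<bar>f c x\<bar> = norm c * \<bar>f ?u x\<bar>"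
      using \<open>c \<noteq> 0\<close> by (simp add: abs_div)
    moreover have "norm c * (N c0 / 2) < norm c * \<bar>f ?u x\<bar>"
      using x(2) \<open>c \<noteq> 0\<close> by (intro mult_strict_left_mono) auto
    ultimately show ?thesis
      using x(1) by (intro bexI[of _ x]) (simp_all add: mult.commute)
  qed
  then show ?thesis
    using that[of "N c0 / 2"] \<open>N c0 > 0\<close> by (simp add: f_def)
qed

lemma condition_number_finite:
  fixes S :: "'n::finite \<Rightarrow> real^2 \<Rightarrow> real"
  assumes T: "compact T" "closure (interior T) = T" "T \<noteq> {}" and cont: "\<And>j. continuous_on T (S j)"
    and nonneg: "\<And>j x. x \<in> T \<Longrightarrow> 0 \<le> S j x" and unity: "\<And>x. x \<in> T \<Longrightarrow> (\<Sum>j\<in>UNIV. S j x) = 1"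
    and indep: "\<And>c :: real^'n. (\<forall>x\<in>T. (\<Sum>j\<in>UNIV. c $ j * S j x) = 0) \<Longrightarrow> c = 0"
  shows "\<exists>\<kappa>. condition_number T S \<le> ennreal \<kappa>"
proof -
  obtain \<delta> where \<delta>: "\<delta> > 0"
    "\<And>c :: real^'n. c \<noteq> 0 \<Longrightarrow> \<exists>x\<in>T. \<delta> * norm c < \<bar>\<Sum>j\<in>UNIV. c $ j * S j x\<bar>"
    using combination_bounded_below[of T S, OF T(3) nonneg unity indep] by blast
  define L where "L c = Linf_norm T (\<lambda>x. \<Sum>j\<in>UNIV. c $ j * S j x)" for c :: "real^'n"
  have L_eq: "L c = (SUP x\<in>T. ennreal \<bar>\<Sum>j\<in>UNIV. c $ j * S j x\<bar>)" for c
    unfolding L_def by (intro Linf_norm_eq_SUP T continuous_intros cont)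
  have le_max: "\<bar>c $ j\<bar> \<le> (MAX j. \<bar>c $ j\<bar>)" for c :: "real^'n" and j
    by (intro Max_ge) auto
  have "L c / max_abs c \<le> 1" if c: "c \<noteq> 0" for c
  proof -
    obtain j where "c $ j \<noteq> 0"
      using c by (auto simp: vec_eq_iff)
    then have pos: "0 < (MAX j. \<bar>c $ j\<bar>)"
      using le_max[of c j] by linarith
    have "L c \<le> max_abs c"
      unfolding L_eq max_abs_def
      by (intro SUP_least ennreal_leI abs_combination_le nonneg unity le_max)
    then have "L c / max_abs c \<le> max_abs c / max_abs c"
      by (rule divide_right_mono_ennreal)
    also have "\<dots> = 1"
      using pos by (intro ennreal_divide_self) (auto simp: max_abs_def)
    finally show ?thesis .
  qed
  then have 1: "(SUP c \<in> UNIV - {0}. L c / max_abs c) \<le> 1"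
    by (intro SUP_least) auto
  have "max_abs c / L c \<le> ennreal (1 / \<delta>)" if c: "c \<noteq> 0" for c
  proof -
    obtain x where x: "x \<in> T" "\<delta> * norm c < \<bar>\<Sum>j\<in>UNIV. c $ j * S j x\<bar>"
      using \<delta>(2)[OF c] by blast
    have "ennreal (\<delta> * norm c) \<le> ennreal \<bar>\<Sum>j\<in>UNIV. c $ j * S j x\<bar>"
      using x(2) by (intro ennreal_leI) simp
    also have "\<dots> \<le> L c"
      unfolding L_eq by (intro SUP_upper x(1))
    finally have lower: "ennreal (\<delta> * norm c) \<le> L c" .
    have "max_abs c \<le> ennreal (norm c)"
      unfolding max_abs_def by (intro ennreal_leI) (auto intro!: Max.boundedI component_le_norm_cart)
    also have "\<dots> = ennreal (1 / \<delta>) * ennreal (\<delta> * norm c)"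
      using \<delta>(1) by (simp add: ennreal_mult[symmetric])
    also have "\<dots> \<le> ennreal (1 / \<delta>) * L c"
      using lower by (intro mult_left_mono) auto
    finally have le: "max_abs c \<le> ennreal (1 / \<delta>) * L c" .
    have "0 < ennreal (\<delta> * norm c)"
      using \<delta>(1) c by simp
    then have "0 < L c"
      using lower by (rule less_le_trans)
    then show ?thesis
      using le by (intro divide_le_posI_ennreal) (simp_all add: mult.commute)
  qed
  then have 2: "(SUP c \<in> UNIV - {0}. max_abs c / L c) \<le> ennreal (1 / \<delta>)"
    by (intro SUP_least) auto
  have "condition_number T S \<le> 1 * ennreal (1 / \<delta>)"
    using mult_mono[OF 1 2] by (simp add: condition_number_def L_def)
  then show ?thesis
    by auto
qed

section \<open>Affine invariance of admissible bases\<close>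

lemma Ck_on_imp_continuous_on: "Ck_on k A f \<Longrightarrow> continuous_on A f"
proof (cases k)
  case (Suc n)
  assume "Ck_on k A f"
  then obtain g :: "2 \<Rightarrow> real^2 \<Rightarrow> real" where
    "\<And>x. x \<in> A \<Longrightarrow> (f has_derivative (\<lambda>h. \<Sum>i\<in>UNIV. g i x * h $ i)) (at x within A)"
    unfolding Suc Ck_on.simps by blast
  then show ?thesis
    by (rule has_derivative_continuous_on)
qed simp

lemma admissible_basisD:
  assumes "admissible_basis v S"
  shows "continuous_on (triangle_hull v) (S j)"
    and "x \<in> triangle_hull v \<Longrightarrow> 0 \<le> S j x"
    and "x \<in> triangle_hull v \<Longrightarrow> (\<Sum>j\<in>UNIV. S j x) = 1"
    and "(\<forall>x\<in>triangle_hull v. (\<Sum>j\<in>UNIV. c $ j * S j x) = 0) \<Longrightarrow> c = 0"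
proof -
  have basis: "is_basis_on (triangle_hull v) (S35 v) S"
    using assms by (simp add: admissible_basis_def)
  then have "S j \<in> S35 v"
    by (simp add: is_basis_on_def)
  then show "continuous_on (triangle_hull v) (S j)"
    unfolding S35_def using Ck_on_imp_continuous_on by blast
  show "(\<forall>x\<in>triangle_hull v. (\<Sum>j\<in>UNIV. c $ j * S j x) = 0) \<Longrightarrow> c = 0"
    using basis by (simp add: is_basis_on_def)
  obtain w K where "\<And>j. w j > (0::real)"
    "\<And>j x. x \<in> triangle_hull v \<Longrightarrow> S j x = w j * simplex_spline v (K j) x"
    using assms unfolding admissible_basis_def by metis
  moreover have "0 \<le> simplex_spline v (K j) x"
    by (simp add: simplex_spline_def Let_def)
  ultimately show "x \<in> triangle_hull v \<Longrightarrow> 0 \<le> S j x"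
    by (simp add: less_imp_le)
  show "x \<in> triangle_hull v \<Longrightarrow> (\<Sum>j\<in>UNIV. S j x) = 1"
    using assms by (simp add: admissible_basis_def)
qed

definition bary_point :: "(3 \<Rightarrow> real^2) \<Rightarrow> real^3 \<Rightarrow> real^2" where
  "bary_point v b = (\<Sum>i\<in>UNIV. b $ i *\<^sub>R v i)"

text \<open>A finite set that contains the barycentric coordinates of the ten vertices of the split,
  for instance \<open>(1/2, 1/4, 1/4)\<close> for the midpoint of two edge midpoints and \<open>(1/3, 1/3, 1/3)\<close> for the
  centroid. A box of values replaces the list of the ten.\<close>

definition knot_weights :: "(real^3) set" where
  "knot_weights = {b. (\<forall>i. b $ i \<in> {0, 1/4, 1/3, 1/2, 1}) \<and> (\<Sum>i\<in>UNIV. b $ i) = 1}"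

lemma finite_knot_weights: "finite knot_weights"
proof (rule finite_subset)
  show "knot_weights \<subseteq> (\<lambda>f. \<chi> i. f i) ` (UNIV \<rightarrow>\<^sub>E {0, 1/4, 1/3, 1/2, 1})"
  proof
    fix b :: "real^3" assume "b \<in> knot_weights"
    then have "b = (\<chi> i. (\<lambda>i. b $ i) i)" "(\<lambda>i. b $ i) \<in> UNIV \<rightarrow>\<^sub>E {0, 1/4, 1/3, 1/2, 1}"
      by (auto simp: knot_weights_def)
    then show "b \<in> (\<lambda>f. \<chi> i. f i) ` (UNIV \<rightarrow>\<^sub>E {0, 1/4, 1/3, 1/2, 1})"
      by (rule image_eqI)
  qed
qed (simp add: finite_PiE)

lemma ps12_vertices_subset: "ps12_vertices v \<subseteq> bary_point v ` knot_weights"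
proof
  fix p assume p: "p \<in> ps12_vertices v"
  have mk: "p \<in> bary_point v ` knot_weights"
    if "a \<in> {0, 1/4, 1/3, 1/2, 1}" "b \<in> {0, 1/4, 1/3, 1/2, 1}" "c \<in> {0, 1/4, 1/3, 1/2, 1}"
      "a + b + c = 1" "p = a *\<^sub>R v 1 + b *\<^sub>R v 2 + c *\<^sub>R v 3" for a b c :: real
  proof (rule image_eqI)
    show "p = bary_point v (vector [a, b, c])"
      using that(5) by (simp add: bary_point_def sum_3)
    show "vector [a, b, c] \<in> knot_weights"
      using that(1-4) by (simp add: knot_weights_def forall_3 sum_3)
  qed
  note coords = midpoint_def vec_eq_iff field_simps
  consider "p = v 1" | "p = v 2" | "p = v 3" | "p = midpoint (v 1) (v 2)" | "p = midpoint (v 2) (v 3)"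
    | "p = midpoint (v 1) (v 3)" | "p = midpoint (midpoint (v 1) (v 2)) (midpoint (v 1) (v 3))"
    | "p = midpoint (midpoint (v 1) (v 2)) (midpoint (v 2) (v 3))"
    | "p = midpoint (midpoint (v 2) (v 3)) (midpoint (v 1) (v 3))" | "p = (1/3) *\<^sub>R (v 1 + v 2 + v 3)"
    using p unfolding ps12_vertices_def ps12_corners_def Let_def by blast
  then show "p \<in> bary_point v ` knot_weights"
  proof cases
    case 1 then show ?thesis by (intro mk[of 1 0 0]) simp_all
  next
    case 2 then show ?thesis by (intro mk[of 0 1 0]) simp_all
  next
    case 3 then show ?thesis by (intro mk[of 0 0 1]) simp_all
  next
    case 4 then show ?thesis by (intro mk[of "1/2" "1/2" 0]) (simp_all add: coords)
  next
    case 5 then show ?thesis by (intro mk[of 0 "1/2" "1/2"]) (simp_all add: coords)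
  next
    case 6 then show ?thesis by (intro mk[of "1/2" 0 "1/2"]) (simp_all add: coords)
  next
    case 7 then show ?thesis by (intro mk[of "1/2" "1/4" "1/4"]) (simp_all add: coords)
  next
    case 8 then show ?thesis by (intro mk[of "1/4" "1/2" "1/4"]) (simp_all add: coords)
  next
    case 9 then show ?thesis by (intro mk[of "1/4" "1/4" "1/2"]) (simp_all add: coords)
  next
    case 10 then show ?thesis by (intro mk[of "1/3" "1/3" "1/3"]) (simp_all add: coords)
  qed
qed

definition knot_labels :: "(3 \<Rightarrow> real^2) \<Rightarrow> (39 \<Rightarrow> real^2 \<Rightarrow> real) \<Rightarrow> (39 \<Rightarrow> (real^3) multiset) \<Rightarrow> bool" where
  "knot_labels v S L \<longleftrightarrow>
    (\<forall>j. L j \<in> multisets_of_size knot_weights 8 \<and>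
         admissible_knots v (image_mset (bary_point v) (L j))) \<and>
    (\<exists>w. \<forall>j. \<forall>x\<in>triangle_hull v. S j x = w j * simplex_spline v (image_mset (bary_point v) (L j)) x)"

lemma knot_labels_exist:
  assumes "admissible_basis v S"
  obtains L where "knot_labels v S L"
proof -
  obtain w K where K: "\<And>j. admissible_knots v (K j)"
    and S: "\<And>j x. x \<in> triangle_hull v \<Longrightarrow> S j x = w j * simplex_spline v (K j) x"
    using assms unfolding admissible_basis_def by metis
  define L where "L j = image_mset (inv_into knot_weights (bary_point v)) (K j)" for j
  have sub: "set_mset (K j) \<subseteq> bary_point v ` knot_weights" for j
    using K[of j] ps12_vertices_subset unfolding admissible_knots_def by blast
  have K_eq: "image_mset (bary_point v) (L j) = K j" for j
  proof -
    have "image_mset (bary_point v) (L j) = image_mset id (K j)"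
      unfolding L_def multiset.map_comp
      using sub[of j] by (intro image_mset_cong) (auto simp: f_inv_into_f)
    then show ?thesis by simp
  qed
  have "L j \<in> multisets_of_size knot_weights 8" for j
    using sub[of j] K[of j] inv_into_into[of _ "bary_point v" knot_weights]
    by (auto simp: multisets_of_size_def L_def admissible_knots_def)
  then have "knot_labels v S L"
    unfolding knot_labels_def K_eq using K S by blast
  then show ?thesis ..
qed

lemma affine_bary_point:
  assumes "linear g" "\<And>i. d + g (v i) = v' i" "(\<Sum>i\<in>UNIV. b $ i) = 1"
  shows "d + g (bary_point v b) = bary_point v' b"
proof -
  have "bary_point v' b = (\<Sum>i\<in>UNIV. b $ i) *\<^sub>R d + g (bary_point v b)"
    using assms(1) by (simp add: bary_point_def assms(2)[symmetric] scaleR_add_right sum.distrib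
      scaleR_sum_left linear_sum linear_scale)
  then show ?thesis
    using assms(3) by simp
qed

text \<open>The function \<open>F\<close> is the fibre volume of a simplex over \<open>K\<close>. The factors \<open>p\<close> and \<open>q\<close> may a priori be
  \<open>0\<close>; for elements of a basis this is excluded later by linear independence, without computing
  any volume.\<close>

lemma simplex_spline_affine:
  assumes K: "admissible_knots v K" and K': "admissible_knots v' (image_mset (\<lambda>x. d + g x) K)"
    and g: "linear g" "inj g"
  obtains F p q where "\<And>x. simplex_spline v K x = p * F x"
    "\<And>x. simplex_spline v' (image_mset (\<lambda>x. d + g x) K) (d + g x) = q * F x"
proof -
  let ?K' = "image_mset (\<lambda>x. d + g x) K"
  define V where "V = (SOME V. lifts_to_simplex K V)"
  define V' where "V' = (SOME V. lifts_to_simplex ?K' V)"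
  have "lifts_to_simplex K V"
    using lift_exists[of K] K someI_ex[of "lifts_to_simplex K"] by (auto simp: admissible_knots_def V_def)
  moreover have "lifts_to_simplex ?K' V'"
    using lift_exists[of ?K'] K' someI_ex[of "lifts_to_simplex ?K'"]
    unfolding admissible_knots_def V'_def by blast
  ultimately obtain r where r: "\<And>x. measure lebesgue {y. (d + g x, y) \<in> convex hull V'} =
                        r * measure lebesgue {y. (x, y) \<in> convex hull V}"
    using fibre_measure_scales[OF _ _ g] by blast
  show ?thesis
  proof
    show "simplex_spline v K x = (measure lebesgue (triangle_hull v) / real (7 choose 2) / measure lebesgue (convex hull V))
      * measure lebesgue {y. (x, y) \<in> convex hull V}" for x
      by (simp add: simplex_spline_def Let_def V_def)
    show "simplex_spline v' ?K' (d + g x) =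
      (measure lebesgue (triangle_hull v') / real (7 choose 2) / measure lebesgue (convex hull V') * r)
      * measure lebesgue {y. (x, y) \<in> convex hull V}" for x
      by (simp add: simplex_spline_def Let_def V'_def[symmetric] r)
  qed
qed

text \<open>The labels determine the elements of the basis up to scaling, and the partition of unity
  then fixes the scaling.\<close>

lemma same_labels_imp_same_condition_number:
  assumes v: "\<not> collinear {v 1, v 2, v 3}" "admissible_basis v S" "knot_labels v S L"
    and v': "\<not> collinear {v' 1, v' 2, v' 3}" "admissible_basis v' S'" "knot_labels v' S' L"
  shows "condition_number (triangle_hull v') S' = condition_number (triangle_hull v) S"
proof -
  let ?T = "triangle_hull v"
  obtain d g where g: "linear g" "inj g" "\<And>i. d + g (v i) = v' i"
    using affine_iso_of_triangles[OF v(1) v'(1)] by blast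
  define \<phi> where "\<phi> x = d + g x" for x
  have T': "triangle_hull v' = \<phi> ` ?T"
    using affine_image_triangle_hull[OF g(1,3)] by (simp add: \<phi>_def)
  have knots: "image_mset (bary_point v') (L j) = image_mset \<phi> (image_mset (bary_point v) (L j))" for j
  proof -
    have "(\<Sum>i\<in>UNIV. b $ i) = 1" if "b \<in># L j" for b
      using v(3) that by (auto simp: knot_labels_def multisets_of_size_def knot_weights_def)
    then show ?thesis
      unfolding multiset.map_comp
      by (intro image_mset_cong) (simp add: \<phi>_def affine_bary_point[OF g(1,3)])
  qed
  obtain w w' where S: "\<And>j x. x \<in> ?T \<Longrightarrow> S j x = w j * simplex_spline v (image_mset (bary_point v) (L j)) x"
    and S': "\<And>j x. x \<in> triangle_hull v' \<Longrightarrow>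
      S' j x = w' j * simplex_spline v' (image_mset \<phi> (image_mset (bary_point v) (L j))) x"
    using v(3) v'(3) unfolding knot_labels_def knots by blast
  have "\<exists>u. \<forall>x\<in>?T. S' j (\<phi> x) = u * S j x" for j
  proof -
    have "admissible_knots v (image_mset (bary_point v) (L j))"
      "admissible_knots v' (image_mset \<phi> (image_mset (bary_point v) (L j)))"
      using v(3) v'(3) unfolding knot_labels_def knots by auto
    then obtain F p q where F: "\<And>x. simplex_spline v (image_mset (bary_point v) (L j)) x = p * F x"
      "\<And>x. simplex_spline v' (image_mset \<phi> (image_mset (bary_point v) (L j))) (\<phi> x) = q * F x"
      using simplex_spline_affine[OF _ _ g(1,2), of v _ v' d] unfolding \<phi>_def by metis
    have "w j * p \<noteq> 0"
    proof
      assume "w j * p = 0"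
      then have "\<forall>x\<in>?T. S j x = 0"
        by (auto simp: S F)
      then have "\<forall>x\<in>?T. (\<Sum>i\<in>UNIV. axis j (1::real) $ i * S i x) = 0"
        by (simp add: axis_def if_distrib[of "\<lambda>a. a * _"] cong: if_cong)
      then have "axis j (1::real) = 0"
        by (rule admissible_basisD(4)[OF v(2)])
      then show False
        by simp
    qed
    then have "S' j (\<phi> x) = (w' j * q / (w j * p)) * S j x" if "x \<in> ?T" for x
      using that T' by (simp add: S S' F)
    then show ?thesis by blast
  qed
  then obtain u where u: "\<And>j x. x \<in> ?T \<Longrightarrow> S' j (\<phi> x) = u j * S j x"
    by metis
  \<comment> \<open>Subtracting the two partitions of unity gives a linear relation between the elements of \<open>S\<close>.\<close>
  have "(\<Sum>j\<in>UNIV. (\<chi> j. u j - 1) $ j * S j x) = 0" if x: "x \<in> ?T" for x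
  proof -
    have "(\<Sum>j\<in>UNIV. u j * S j x) = 1"
      using admissible_basisD(3)[OF v'(2), of "\<phi> x"] x T' by (simp add: u)
    then show ?thesis
      using admissible_basisD(3)[OF v(2) x] by (simp add: left_diff_distrib sum_subtractf)
  qed
  then have "(\<chi> j. u j - 1) = 0"
    using admissible_basisD(4)[OF v(2)] by blast
  then have "u j = 1" for j
    by (simp add: vec_eq_iff)
  then show ?thesis
    using u by (intro condition_number_transfer[where \<phi> = \<phi>] compact_triangle_hull
        closure_interior_triangle_hull v v' admissible_basisD(1)[OF v(2)] admissible_basisD(1)[OF v'(2)] T') simp
qed

theorem mainTheorem6:
  shows "\<exists>\<kappa> :: real. \<forall>v :: 3 \<Rightarrow> real^2. \<not> collinear {v 1, v 2, v 3} \<longrightarrow>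
    (\<forall>S :: 39 \<Rightarrow> real^2 \<Rightarrow> real. admissible_basis v S \<longrightarrow>
      condition_number (triangle_hull v) S \<le> ennreal \<kappa>)"
proof -
  define X where "X = (UNIV :: 39 set) \<rightarrow>\<^sub>E multisets_of_size knot_weights 8"
  have "finite X"
    unfolding X_def by (intro finite_PiE finite_multisets_of_size finite_knot_weights) simp
  have "\<exists>\<kappa>. \<forall>v S. \<not> collinear {v 1, v 2, v 3} \<and> admissible_basis v S \<and> knot_labels v S L \<longrightarrow>
      condition_number (triangle_hull v) S \<le> ennreal \<kappa>" for L
  proof (cases "\<exists>v S. \<not> collinear {v 1, v 2, v 3} \<and> admissible_basis v S \<and> knot_labels v S L")
    case True
    then obtain v S where v: "\<not> collinear {v 1, v 2, v 3}" "admissible_basis v S" "knot_labels v S L"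
      by blast
    have "triangle_hull v \<noteq> {}"
      by (simp add: triangle_hull_def)
    then obtain \<kappa> where "condition_number (triangle_hull v) S \<le> ennreal \<kappa>"
      using condition_number_finite[OF compact_triangle_hull closure_interior_triangle_hull[OF v(1)] _
          admissible_basisD[OF v(2)]] by blast
    then show ?thesis
      using same_labels_imp_same_condition_number[OF v] by metis
  qed blast
  then obtain \<kappa> where \<kappa>: "\<And>L v S. \<not> collinear {v 1, v 2, v 3} \<Longrightarrow> admissible_basis v S \<Longrightarrow>
      knot_labels v S L \<Longrightarrow> condition_number (triangle_hull v) S \<le> ennreal (\<kappa> L)"
    by metis
  have "condition_number (triangle_hull v) S \<le> ennreal (MAX L\<in>X. \<kappa> L)"
    if v: "\<not> collinear {v 1, v 2, v 3}" and S: "admissible_basis v S" for v S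
  proof -
    obtain L where L: "knot_labels v S L"
      using knot_labels_exist[OF S] .
    then have "L \<in> X"
      by (auto simp: X_def knot_labels_def)
    then have "ennreal (\<kappa> L) \<le> ennreal (MAX L\<in>X. \<kappa> L)"
      using \<open>finite X\<close> by (intro ennreal_leI Max_ge) auto
    then show ?thesis
      using \<kappa>[OF v S L] by (rule order_trans[rotated])
  qed
  then show ?thesis
    by blast
qed

end
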